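(* For $\varepsilon_1,\varepsilon_2>0$, $\tilde d_{max}\in\mathbb{Z}_{\ge0}$ and a graph $G$ on $n$ nodes, let $\hat f_\triangle(G,\varepsilon_1,\varepsilon_2,\tilde d_{max})$ be the output of $\mathsf{Local2Rounds}_\triangle$. Then for all $\varepsilon_1,\varepsilon_2>0$, $\tilde d_{max}\in\mathbb{Z}_{\ge0}$, and all graphs $G$ on $n$ nodes whose maximum degree $d_{max}$ is at most $\tilde d_{max}$, $$\mathbb{E}\big[(\hat f_\triangle(G,\varepsilon_1,\varepsilon_2,\tilde d_{max})-f_\triangle(G))^2\big]\le O\!\left(\frac{e^{\varepsilon_1}}{(1-e^{\varepsilon_1})^2}\left(\tilde d_{max}^{\,3}\,n+\frac{e^{\varepsilon_1}}{\varepsilon_2^2}\,\tilde d_{max}^{\,2}\,n\right)\right),$$ where the expectation is over the randomness of the algorithm and the implied constant is absolute.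
   Context: Graphs are undirected on nodes (users) $V=\{v_1,\dots,v_n\}$ with symmetric adjacency matrix $\mathbf{A}=(a_{i,j})\in\{0,1\}^{n\times n}$ with zero diagonal; $\mathbf{a}_i$ is the $i$-th row (neighbor list of $v_i$). $f_\triangle(G)$ is the number of triangles in $G$. Randomized response: $RR_{\varepsilon_1}$ maps a bit $a$ to $1-a$ with probability $p_1=\frac{1}{e^{\varepsilon_1}+1}$ and to $a$ with probability $1-p_1$. $\mathrm{Lap}(b)$ is a Laplace random variable with mean $0$ and scale $b$ ($\mathrm{Lap}(0)=0$). Graph projection: given a neighbor list $\mathbf{a}_i$ with $d_i$ ones and $\tilde d_{max}$, if $d_i>\tilde d_{max}$ then $\tilde d_{max}$ of the $d_i$ neighbors are selected uniformly at random and the other ones are set to $0$; otherwise $\mathbf{a}_i$ is unchanged. Algorithm $\mathsf{Local2Rounds}_\triangle$. First round: each user $v_i$ releases $R_i=(RR_{\varepsilon_1}(a_{i,1}),\dots,RR_{\varepsilon_1}(a_{i,i-1}))$; the data collector publishes the noisy graph $G'=(V,E')$ in which, for $i>j$, $(v_i,v_j)\in E'$ iff the $j$-th bit of $R_i$ is $1$. Second round: each user $v_i$ applies graph projection with $\tilde d_{max}$ to $\mathbf{a}_i$, and with the projected list computes $t_i=|\{(v_i,v_j,v_k): j<k<i,\ a_{i,j}=a_{i,k}=1,\ (v_j,v_k)\in E'\}|$, $s_i=|\{(v_i,v_j,v_k): j<k<i,\ a_{i,j}=a_{i,k}=1\}|$, $w_i=t_i-p_1s_i$, and releases $\hat w_i=w_i+\mathrm{Lap}(\tilde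 d_{max}/\varepsilon_2)$. All random choices are independent. The output is $\frac{1}{1-2p_1}\sum_{i=1}^n\hat w_i$. *)

theory Defs
  imports "HOL-Probability.Probability" "HOL-Probability.Product_PMF"
begin

text \<open>
  A graph on the nodes \<open>1, \<dots>, n\<close> is given by its adjacency matrix, whose entries
  are read as Booleans; entries with an index outside \<open>{1..n}\<close> are never inspected.
\<close>

definition adjacency_matrix :: "nat \<Rightarrow> (nat \<Rightarrow> nat \<Rightarrow> bool) \<Rightarrow> bool" where
  "adjacency_matrix n A \<longleftrightarrow>
     (\<forall>i\<in>{1..n}. \<forall>j\<in>{1..n}. A i j = A j i) \<and> (\<forall>i\<in>{1..n}. \<not> A i i)"

definition neighbors :: "nat \<Rightarrow> (nat \<Rightarrow> nat \<Rightarrow> bool) \<Rightarrow> nat \<Rightarrow> nat set" where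
  "neighbors n A i = {j \<in> {1..n}. A i j}"

text \<open>The additional \<open>0\<close> only matters for the graph without nodes.\<close>

definition max_degree :: "nat \<Rightarrow> (nat \<Rightarrow> nat \<Rightarrow> bool) \<Rightarrow> nat" where
  "max_degree n A = Max (insert 0 ((\<lambda>i. card (neighbors n A i)) ` {1..n}))"

definition triangle_count :: "nat \<Rightarrow> (nat \<Rightarrow> nat \<Rightarrow> bool) \<Rightarrow> nat" where
  "triangle_count n A =
     card {T. T \<subseteq> {1..n} \<and> card T = 3 \<and> (\<forall>u\<in>T. \<forall>v\<in>T. u \<noteq> v \<longrightarrow> A u v)}"

definition flip_prob :: "real \<Rightarrow> real" where
  "flip_prob \<epsilon> = 1 / (exp \<epsilon> + 1)"

definition randomized_response :: "real \<Rightarrow> bool \<Rightarrow> bool pmf" where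
  "randomized_response \<epsilon> a =
     map_pmf (\<lambda>flip. if flip then \<not> a else a) (bernoulli_pmf (flip_prob \<epsilon>))"

definition laplace :: "real \<Rightarrow> real measure" where
  "laplace b =
     (if b = 0 then return borel 0
      else density lborel (\<lambda>x. ennreal (exp (- \<bar>x\<bar> / b) / (2 * b))))"

text \<open>Neighbor lists are represented by the set of positions of their ones.\<close>

definition graph_projection :: "nat \<Rightarrow> nat set \<Rightarrow> nat set pmf" where
  "graph_projection d N =
     (if card N > d then pmf_of_set {S. S \<subseteq> N \<and> card S = d} else return_pmf N)"

text \<open>
  First round: \<open>R (i, j)\<close> with \<open>j < i\<close> is the \<open>j\<close>-th bit released by user \<open>i\<close>.
\<close>

definition first_round :: "nat \<Rightarrow> (nat \<Rightarrow> nat \<Rightarrow> bool) \<Rightarrow> real \<Rightarrow> (nat \<times> nat \<Rightarrow> bool) pmf" where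
  "first_round n A \<epsilon>\<^sub>1 =
     Pi_pmf (SIGMA i:{1..n}. {1..<i}) False (\<lambda>(i, j). randomized_response \<epsilon>\<^sub>1 (A i j))"

definition noisy_edges :: "nat \<Rightarrow> (nat \<times> nat \<Rightarrow> bool) \<Rightarrow> nat set set" where
  "noisy_edges n R = {{i, j} | i j. i \<in> {1..n} \<and> j \<in> {1..<i} \<and> R (i, j)}"

definition projected_lists ::
    "nat \<Rightarrow> (nat \<Rightarrow> nat \<Rightarrow> bool) \<Rightarrow> nat \<Rightarrow> (nat \<Rightarrow> nat set) pmf" where
  "projected_lists n A d = Pi_pmf {1..n} {} (\<lambda>i. graph_projection d (neighbors n A i))"

text \<open>
  Second round, for a user \<open>i\<close> holding the projected neighbor set \<open>N\<close>, when the noisy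
  graph has the edge set \<open>E\<close>: the quantities \<open>t\<^sub>i\<close>, \<open>s\<^sub>i\<close> and \<open>w\<^sub>i\<close>.
\<close>

definition noisy_triangles :: "nat set set \<Rightarrow> nat set \<Rightarrow> nat \<Rightarrow> nat" where
  "noisy_triangles E N i =
     card {(i', j, k). i' = i \<and> j < k \<and> k < i \<and> j \<in> N \<and> k \<in> N \<and> {j, k} \<in> E}"

definition two_stars :: "nat set \<Rightarrow> nat \<Rightarrow> nat" where
  "two_stars N i = card {(i', j, k). i' = i \<and> j < k \<and> k < i \<and> j \<in> N \<and> k \<in> N}"

definition user_value :: "real \<Rightarrow> nat set set \<Rightarrow> nat set \<Rightarrow> nat \<Rightarrow> real" where
  "user_value \<epsilon>\<^sub>1 E N i =
     real (noisy_triangles E N i) - flip_prob \<epsilon>\<^sub>1 * real (two_stars N i)"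

text \<open>
  The probability space of the algorithm: a point \<open>((R, N), L)\<close> consists of the released
  bits \<open>R\<close>, the projected neighbor sets \<open>N i\<close> and the Laplace noises \<open>L i\<close>, all independent.
\<close>

definition local_two_rounds_space ::
    "nat \<Rightarrow> (nat \<Rightarrow> nat \<Rightarrow> bool) \<Rightarrow> real \<Rightarrow> real \<Rightarrow> nat \<Rightarrow>
     (((nat \<times> nat \<Rightarrow> bool) \<times> (nat \<Rightarrow> nat set)) \<times> (nat \<Rightarrow> real)) measure" where
  "local_two_rounds_space n A \<epsilon>\<^sub>1 \<epsilon>\<^sub>2 d =
     measure_pmf (pair_pmf (first_round n A \<epsilon>\<^sub>1) (projected_lists n A d))
       \<Otimes>\<^sub>M (\<Pi>\<^sub>M i\<in>{1..n}. laplace (real d / \<epsilon>\<^sub>2))"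

definition local_two_rounds_output ::
    "nat \<Rightarrow> real \<Rightarrow> ((nat \<times> nat \<Rightarrow> bool) \<times> (nat \<Rightarrow> nat set)) \<times> (nat \<Rightarrow> real) \<Rightarrow> real" where
  "local_two_rounds_output n \<epsilon>\<^sub>1 = (\<lambda>((R, N), L).
     1 / (1 - 2 * flip_prob \<epsilon>\<^sub>1) *
       (\<Sum>i=1..n. user_value \<epsilon>\<^sub>1 (noisy_edges n R) (N i) i + L i))"

end

theory Submission
  imports Defs
begin

text \<open>
  When the maximum degree is at most \<open>d\<close> the projection is the identity, so the only randomness is
  that of the randomized response and the Laplace noise. Exchanging sums, the noiseless part of the
  error is \<open>1 / (1 - 2p)\<close> times \<open>\<Sum> c\<^sub>e Z\<^sub>e\<close> over pairs \<open>e = (k, j)\<close> with \<open>j < k\<close>, where \<open>c\<^sub>e\<close> is the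
  number of common neighbors \<open>i > k\<close> of \<open>k\<close> and \<open>j\<close>, and the \<open>Z\<^sub>e\<close> are independent, centered and
  of variance \<open>p(1 - p)\<close>. Since \<open>c\<^sub>e \<le> d\<close> and \<open>\<Sum> c\<^sub>e \<le> n d\<^sup>2\<close>, we get \<open>\<Sum> c\<^sub>e\<^sup>2 \<le> n d\<^sup>3\<close>. The Laplace part
  has variance \<open>2n(d/\<epsilon>\<^sub>2)\<^sup>2 / (1 - 2p)\<^sup>2\<close>, and the two parts are combined by
  \<open>(x + y)\<^sup>2 \<le> 2x\<^sup>2 + 2y\<^sup>2\<close>, which makes their cross term irrelevant.
\<close>

section \<open>Second moments of independent sums and integrals over product measures\<close>

text \<open>Expanding the square gives a double sum of products. Off the diagonal, independence
  factors the expectation into a product of zero means, so only the diagonal survives. The variables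
  themselves are integrable because a square integrable function on a probability space is.\<close>

lemma (in prob_space) sum_indep_centered_square:
  fixes X :: "'i \<Rightarrow> 'a \<Rightarrow> real"
  assumes fin: "finite I" and indep: "indep_vars (\<lambda>_. borel) X I"
    and sq: "\<And>i. i \<in> I \<Longrightarrow> integrable M (\<lambda>\<omega>. (X i \<omega>)\<^sup>2)"
    and centered: "\<And>i. i \<in> I \<Longrightarrow> expectation (X i) = 0"
  shows "integrable M (\<lambda>\<omega>. (\<Sum>i\<in>I. X i \<omega>)\<^sup>2)"
    and "expectation (\<lambda>\<omega>. (\<Sum>i\<in>I. X i \<omega>)\<^sup>2) = (\<Sum>i\<in>I. expectation (\<lambda>\<omega>. (X i \<omega>)\<^sup>2))"
proof -
  have int: "integrable M (X i)" if "i \<in> I" for i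
  proof (rule square_integrable_imp_integrable)
    show "random_variable borel (X i)"
      using indep that unfolding indep_vars_def2 by blast
  qed (use that sq in simp)
  have prods: "integrable M (\<lambda>\<omega>. X i \<omega> * X j \<omega>) \<and>
      expectation (\<lambda>\<omega>. X i \<omega> * X j \<omega>) = (if i = j then expectation (\<lambda>\<omega>. (X i \<omega>)\<^sup>2) else 0)"
    if "i \<in> I" "j \<in> I" for i j
  proof (cases "i = j")
    case True
    then show ?thesis using sq[OF that(1)] by (simp add: power2_eq_square)
  next
    case False
    have "indep_vars (\<lambda>_. borel) X {i, j}"
      using indep that by (intro indep_vars_subset[OF indep]) auto
    then show ?thesis
      using indep_vars_lebesgue_integral[of "{i, j}" X] indep_vars_integrable[of "{i, j}" X]
        int that centered False by auto
  qed
  have expand: "(\<Sum>i\<in>I. X i \<omega>)\<^sup>2 = (\<Sum>i\<in>I. \<Sum>j\<in>I. X i \<omega> * X j \<omega>)" for \<omega>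
    by (simp add: power2_eq_square sum_product)
  show "integrable M (\<lambda>\<omega>. (\<Sum>i\<in>I. X i \<omega>)\<^sup>2)"
    unfolding expand using prods by auto
  have "expectation (\<lambda>\<omega>. (\<Sum>i\<in>I. X i \<omega>)\<^sup>2) =
      (\<Sum>i\<in>I. \<Sum>j\<in>I. expectation (\<lambda>\<omega>. X i \<omega> * X j \<omega>))"
    unfolding expand using prods by (simp add: Bochner_Integration.integral_sum)
  also have "\<dots> = (\<Sum>i\<in>I. \<Sum>j\<in>I. if i = j then expectation (\<lambda>\<omega>. (X i \<omega>)\<^sup>2) else 0)"
    using prods by (intro sum.cong refl) auto
  finally show "expectation (\<lambda>\<omega>. (\<Sum>i\<in>I. X i \<omega>)\<^sup>2) = (\<Sum>i\<in>I. expectation (\<lambda>\<omega>. (X i \<omega>)\<^sup>2))"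
    using fin by simp
qed

text \<open>Independence amounts to the joint law being the product of the marginals. The joint map
  is \<open>restrict\<close> to \<open>I\<close>, which is the identity on the product space, and
  each marginal is the corresponding factor. This criterion presupposes a nonempty index set, hence
  the case split.\<close>

lemma indep_vars_PiM_coordinates:
  assumes M: "\<And>i. i \<in> I \<Longrightarrow> prob_space (M i)"
  shows "prob_space.indep_vars (PiM I M) M (\<lambda>i \<omega>. \<omega> i) I"
proof -
  interpret P: prob_space "PiM I M" by (intro prob_space_PiM M)
  show ?thesis
  proof (cases "I = {}")
    case True
    then show ?thesis unfolding P.indep_vars_def P.indep_sets_def by simp
  next
    case False
    have "distr (PiM I M) (PiM I M) (\<lambda>\<omega>. restrict \<omega> I) = distr (PiM I M) (PiM I M) (\<lambda>\<omega>. \<omega>)"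
      by (intro distr_cong) (auto simp: space_PiM PiE_restrict)
    also have "\<dots> = PiM I M" by (simp add: distr_id)
    also have "\<dots> = PiM I (\<lambda>i. distr (PiM I M) (M i) (\<lambda>\<omega>. \<omega> i))"
      by (intro PiM_cong refl) (simp add: distr_PiM_component M)
    finally show ?thesis
      by (subst P.indep_vars_iff_distr_eq_PiM'[OF False]) auto
  qed
qed

text \<open>The preimage of \<open>A\<close> under \<open>snd\<close> is
  \<open>space M \<times> A\<close>, whose measure is that of \<open>A\<close> because
  \<open>M\<close> has total mass one.\<close>

lemma (in prob_space) distr_pair_snd:
  assumes "sigma_finite_measure N"
  shows "distr (M \<Otimes>\<^sub>M N) N snd = N"
proof (intro measure_eqI)
  interpret N: sigma_finite_measure N by fact
  fix A assume A: "A \<in> sets (distr (M \<Otimes>\<^sub>M N) N snd)"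
  then have "emeasure (distr (M \<Otimes>\<^sub>M N) N snd) A = emeasure (M \<Otimes>\<^sub>M N) (space M \<times> A)"
    by (auto simp: emeasure_distr space_pair_measure dest: sets.sets_into_space
        intro!: arg_cong2[where f = emeasure])
  with A show "emeasure (distr (M \<Otimes>\<^sub>M N) N snd) A = emeasure N A"
    by (simp add: N.emeasure_pair_measure_Times emeasure_space_1)
qed simp

text \<open>The pointwise bound decouples the two coordinates; each remaining square depends on one
  coordinate only and is integrated over that factor, since both marginals of the product are the
  factors themselves.\<close>

lemma pair_measure_integral_square_add_le:
  fixes f :: "'a \<Rightarrow> real" and g :: "'b \<Rightarrow> real"
  assumes "prob_space M" "prob_space N"
    and f_meas[measurable]: "f \<in> borel_measurable M" and g_meas[measurable]: "g \<in> borel_measurable N"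
    and f: "integrable M (\<lambda>x. (f x)\<^sup>2)" and g: "integrable N (\<lambda>y. (g y)\<^sup>2)"
  shows "integrable (M \<Otimes>\<^sub>M N) (\<lambda>z. (f (fst z) + g (snd z))\<^sup>2)"
    and "(LINT z|(M \<Otimes>\<^sub>M N). (f (fst z) + g (snd z))\<^sup>2) \<le> 2 * (LINT x|M. (f x)\<^sup>2) + 2 * (LINT y|N. (g y)\<^sup>2)"
proof -
  interpret M: prob_space M by fact
  interpret N: prob_space N by fact
  have fst: "distr (M \<Otimes>\<^sub>M N) M fst = M" by (rule N.distr_pair_fst)
  have snd: "distr (M \<Otimes>\<^sub>M N) N snd = N"
    by (rule M.distr_pair_snd) (rule N.sigma_finite_measure_axioms)
  have f': "integrable (M \<Otimes>\<^sub>M N) (\<lambda>z. (f (fst z))\<^sup>2)"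
      "(LINT z|(M \<Otimes>\<^sub>M N). (f (fst z))\<^sup>2) = (LINT x|M. (f x)\<^sup>2)"
    using integrable_distr_eq[of fst "M \<Otimes>\<^sub>M N" M "\<lambda>x. (f x)\<^sup>2"]
      integral_distr[of fst "M \<Otimes>\<^sub>M N" M "\<lambda>x. (f x)\<^sup>2"] f by (simp_all add: fst)
  have g': "integrable (M \<Otimes>\<^sub>M N) (\<lambda>z. (g (snd z))\<^sup>2)"
      "(LINT z|(M \<Otimes>\<^sub>M N). (g (snd z))\<^sup>2) = (LINT y|N. (g y)\<^sup>2)"
    using integrable_distr_eq[of snd "M \<Otimes>\<^sub>M N" N "\<lambda>x. (g x)\<^sup>2"]
      integral_distr[of snd "M \<Otimes>\<^sub>M N" N "\<lambda>x. (g x)\<^sup>2"] g by (simp_all add: snd)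
  have le: "(a + b)\<^sup>2 \<le> 2 * a\<^sup>2 + 2 * b\<^sup>2" for a b :: real
    using zero_le_power2[of "a - b"] by (simp add: power2_eq_square algebra_simps)
  have bound: "integrable (M \<Otimes>\<^sub>M N) (\<lambda>z. 2 * (f (fst z))\<^sup>2 + 2 * (g (snd z))\<^sup>2)"
    using f' g' by auto
  show int: "integrable (M \<Otimes>\<^sub>M N) (\<lambda>z. (f (fst z) + g (snd z))\<^sup>2)"
    by (rule Bochner_Integration.integrable_bound[OF bound]) (auto simp: le)
  have "(LINT z|(M \<Otimes>\<^sub>M N). (f (fst z) + g (snd z))\<^sup>2) \<le>
      (LINT z|(M \<Otimes>\<^sub>M N). 2 * (f (fst z))\<^sup>2 + 2 * (g (snd z))\<^sup>2)"
    by (rule integral_mono[OF int bound]) (auto simp: le)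
  also have "\<dots> = 2 * (LINT x|M. (f x)\<^sup>2) + 2 * (LINT y|N. (g y)\<^sup>2)"
    using f' g' by simp
  finally show "(LINT z|(M \<Otimes>\<^sub>M N). (f (fst z) + g (snd z))\<^sup>2) \<le>
      2 * (LINT x|M. (f x)\<^sup>2) + 2 * (LINT y|N. (g y)\<^sup>2)" .
qed

section \<open>Moments of the Laplace distribution\<close>

lemma sets_laplace [simp, measurable_cong]: "sets (laplace b) = sets borel"
  by (simp add: laplace_def)

text \<open>On the half line the Laplace density is half the density of an exponential distribution.\<close>

lemma has_bochner_integral_laplace_half:
  fixes b :: real
  assumes "b > 0"
  shows "has_bochner_integral lborel
           (\<lambda>x. indicator {0..} x *\<^sub>R (exp (- \<bar>x\<bar> / b) / (2 * b) * x ^ k)) (fact k * b ^ k / 2)"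
proof -
  \<comment> \<open>The zeros in the moment are the shape parameter: the exponential distribution
    with rate \<open>1 / b\<close> is the Erlang distribution of shape 0.\<close>
  have "has_bochner_integral lborel (\<lambda>x. exponential_density (1 / b) x * x ^ k)
      (fact (0 + k) / (fact 0 * (1 / b) ^ k))"
    using nn_integral_erlang_ith_moment[of "1 / b" 0 k] assms
    by (intro has_bochner_integral_nn_integral)
       (auto simp: erlang_density_def ennreal_mult' divide_ennreal)
  then have "has_bochner_integral lborel (\<lambda>x. exponential_density (1 / b) x * x ^ k / 2)
      (fact (0 + k) / (fact 0 * (1 / b) ^ k) / 2)"
    by (rule has_bochner_integral_divide_zero)
  moreover have "exponential_density (1 / b) x * x ^ k / 2 =
      indicator {0..} x *\<^sub>R (exp (- \<bar>x\<bar> / b) / (2 * b) * x ^ k)" for x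
    by (auto simp: erlang_density_def field_simps split: split_indicator)
  moreover have "fact (0 + k) / (fact 0 * (1 / b) ^ k) / 2 = fact k * b ^ k / 2"
    by (simp add: field_simps)
  ultimately show ?thesis by (simp only:)
qed

text \<open>The density is even, so for an even power the two half lines contribute equally; for an
  odd power they cancel.\<close>

lemma has_bochner_integral_laplace_even_moment:
  assumes "b > 0" "even k"
  shows "has_bochner_integral (laplace b) (\<lambda>x. x ^ k) (fact k * b ^ k)"
proof -
  have "has_bochner_integral lborel (\<lambda>x. exp (- \<bar>x\<bar> / b) / (2 * b) * x ^ k)
      (2 *\<^sub>R (fact k * b ^ k / 2))"
    using assms by (intro has_bochner_integral_even_function has_bochner_integral_laplace_half) auto
  then show ?thesis
    using assms by (simp add: laplace_def has_bochner_integral_density)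
qed

lemma has_bochner_integral_laplace_odd_moment:
  assumes "b > 0" "odd k"
  shows "has_bochner_integral (laplace b) (\<lambda>x. x ^ k) 0"
proof -
  have "has_bochner_integral lborel (\<lambda>x. exp (- \<bar>x\<bar> / b) / (2 * b) * x ^ k) 0"
    using assms
    by (intro has_bochner_integral_odd_function[OF has_bochner_integral_laplace_half]) auto
  then show ?thesis
    using assms by (simp add: laplace_def has_bochner_integral_density)
qed

lemma laplace_moments:
  assumes "b \<ge> 0"
  shows "prob_space (laplace b)"
    and "(LINT x|laplace b. x) = 0"
    and "integrable (laplace b) (\<lambda>x. x\<^sup>2)"
    and "(LINT x|laplace b. x\<^sup>2) = 2 * b\<^sup>2"
proof -
  have *: "prob_space (laplace b) \<and> (LINT x|laplace b. x) = 0 \<and>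
      integrable (laplace b) (\<lambda>x. x\<^sup>2) \<and> (LINT x|laplace b. x\<^sup>2) = 2 * b\<^sup>2"
  proof (cases "b = 0")
    \<comment> \<open>This case arises from projection parameter 0: the noise is the point mass at
      0, and all the formulas hold with \<open>b = 0\<close>.\<close>
    case True
    then show ?thesis
      by (auto simp: laplace_def prob_space_return integral_return integrable_iff_bounded
          nn_integral_return)
  next
    case False
    with assms have "b > 0" by simp
    note m = has_bochner_integral_laplace_even_moment[OF this]
      and o = has_bochner_integral_laplace_odd_moment[OF this]
    have "prob_space (laplace b)"
    proof
      \<comment> \<open>The total mass is the moment of order 0.\<close>
      have "has_bochner_integral (laplace b) (\<lambda>x. 1 :: real) 1"
        using m[of 0] by simp
      then have "(\<integral>\<^sup>+x. ennreal 1 \<partial>laplace b) = ennreal 1"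
        by (subst nn_integral_eq_integral) (auto simp: has_bochner_integral_iff)
      then show "emeasure (laplace b) (space (laplace b)) = 1"
        by simp
    qed
    with m[of 2] o[of 1] show ?thesis
      by (simp add: has_bochner_integral_iff)
  qed
  then show "prob_space (laplace b)" "(LINT x|laplace b. x) = 0"
    "integrable (laplace b) (\<lambda>x. x\<^sup>2)" "(LINT x|laplace b. x\<^sup>2) = 2 * b\<^sup>2"
    by simp_all
qed

lemma laplace_noise_sum_square:
  assumes "b \<ge> 0" "finite I"
  shows "integrable (\<Pi>\<^sub>M i\<in>I. laplace b) (\<lambda>L. (\<Sum>i\<in>I. L i)\<^sup>2)"
    and "(LINT L|(\<Pi>\<^sub>M i\<in>I. laplace b). (\<Sum>i\<in>I. L i)\<^sup>2) = 2 * b\<^sup>2 * real (card I)"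
proof -
  let ?P = "\<Pi>\<^sub>M i\<in>I. laplace b"
  note lap = laplace_moments[OF assms(1)]
  interpret P: prob_space ?P by (intro prob_space_PiM lap)
  \<comment> \<open>Composing with the identity only changes the target measure from
    \<open>laplace b\<close> to \<open>borel\<close>.\<close>
  have indep: "P.indep_vars (\<lambda>_. borel) (\<lambda>i L. L i) I"
    by (rule P.indep_vars_compose2[where Y = "\<lambda>_ x. x", OF indep_vars_PiM_coordinates])
       (auto simp: lap)
  have comp: "distr ?P (laplace b) (\<lambda>L. L i) = laplace b" if "i \<in> I" for i
    using distr_PiM_component[of I "\<lambda>_. laplace b" i] that lap by simp
  have push: "integrable ?P (\<lambda>L. (L i)\<^sup>2)" "(LINT L|?P. L i) = 0"
      "(LINT L|?P. (L i)\<^sup>2) = 2 * b\<^sup>2" if "i \<in> I" for i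
    using that lap integrable_distr_eq[of "\<lambda>L. L i" ?P "laplace b" "\<lambda>x. x\<^sup>2"]
      integral_distr[of "\<lambda>L. L i" ?P "laplace b" "\<lambda>x. x\<^sup>2"]
      integral_distr[of "\<lambda>L. L i" ?P "laplace b" "\<lambda>x. x"]
    by (simp_all add: comp)
  show "integrable ?P (\<lambda>L. (\<Sum>i\<in>I. L i)\<^sup>2)"
    by (rule P.sum_indep_centered_square(1)[OF assms(2) indep]) (simp_all add: push)
  show "(LINT L|?P. (\<Sum>i\<in>I. L i)\<^sup>2) = 2 * b\<^sup>2 * real (card I)"
    by (subst P.sum_indep_centered_square(2)[OF assms(2) indep]) (simp_all add: push)
qed

section \<open>Rewriting the counts as sums over pairs of nodes\<close>

text \<open>This is the index set of the bits in \<open>first_round\<close>, larger node first, so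
  that a sum over it is a sum over independent bits.\<close>

definition descending_pairs :: "nat \<Rightarrow> (nat \<times> nat) set" where
  "descending_pairs n = (SIGMA i:{1..n}. {1..<i})"

text \<open>These are the users whose count involves the bit \<open>R (k, j)\<close>: user
  \<open>i\<close> only looks at pairs below itself. The cardinality is therefore the coefficient of
  that bit in the total.\<close>

definition later_common_neighbors :: "nat \<Rightarrow> (nat \<Rightarrow> nat \<Rightarrow> bool) \<Rightarrow> nat \<times> nat \<Rightarrow> nat set" where
  "later_common_neighbors n A = (\<lambda>(k, j). {i \<in> {1..n}. k < i \<and> A i j \<and> A i k})"

lemma finite_descending_pairs [simp]: "finite (descending_pairs n)"
  by (simp add: descending_pairs_def)

lemma finite_later_common_neighbors [simp]: "finite (later_common_neighbors n A e)"
  by (simp add: later_common_neighbors_def split: prod.split)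

lemma card_filter_eq_sum_of_bool:
  "finite D \<Longrightarrow> card {x \<in> D. P x} = (\<Sum>x\<in>D. of_bool (P x))"
  by (simp add: of_bool_def sum.If_cases Int_def)

lemma noisy_edges_iff:
  assumes "(k, j) \<in> descending_pairs n"
  shows "{j, k} \<in> noisy_edges n R \<longleftrightarrow> R (k, j)"
  using assms by (auto simp: noisy_edges_def descending_pairs_def doubleton_eq_iff)

text \<open>The triple \<open>(i, j, k)\<close> is determined by the pair \<open>(k, j)\<close>. The
  form as a sum of indicators over a set independent of \<open>i\<close> is what permits the later
  exchange with the sum over users.\<close>

lemma two_stars_neighbors:
  assumes "i \<in> {1..n}"
  shows "two_stars (neighbors n A i) i =
    (\<Sum>e\<in>descending_pairs n. of_bool (i \<in> later_common_neighbors n A e))"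
proof -
  let ?D = "{e \<in> descending_pairs n. i \<in> later_common_neighbors n A e}"
  have "{(i', j, k). i' = i \<and> j < k \<and> k < i \<and> j \<in> neighbors n A i \<and> k \<in> neighbors n A i} =
      (\<lambda>(k, j). (i, j, k)) ` ?D"
    using assms
    by (auto simp: descending_pairs_def later_common_neighbors_def neighbors_def image_iff)
  then have "two_stars (neighbors n A i) i = card ?D"
    by (simp add: two_stars_def card_image inj_on_def split: prod.splits)
  also have "\<dots> = (\<Sum>e\<in>descending_pairs n. of_bool (i \<in> later_common_neighbors n A e))"
    by (rule card_filter_eq_sum_of_bool) simp
  finally show ?thesis .
qed

lemma noisy_triangles_neighbors:
  assumes "i \<in> {1..n}"
  shows "noisy_triangles (noisy_edges n R) (neighbors n A i) i =
    (\<Sum>e\<in>descending_pairs n. of_bool (i \<in> later_common_neighbors n A e) * of_bool (R e))"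
proof -
  let ?D = "{e \<in> descending_pairs n. i \<in> later_common_neighbors n A e \<and> R e}"
  have "{(i', j, k). i' = i \<and> j < k \<and> k < i \<and> j \<in> neighbors n A i \<and> k \<in> neighbors n A i \<and>
        {j, k} \<in> noisy_edges n R} =
      {(i', j, k). i' = i \<and> j < k \<and> k < i \<and> j \<in> neighbors n A i \<and> k \<in> neighbors n A i \<and> R (k, j)}"
    by (auto simp: neighbors_def noisy_edges_iff descending_pairs_def)
  also have "\<dots> = (\<lambda>(k, j). (i, j, k)) ` ?D"
    using assms
    by (auto simp: descending_pairs_def later_common_neighbors_def neighbors_def image_iff)
  finally have "noisy_triangles (noisy_edges n R) (neighbors n A i) i = card ?D"
    by (simp add: noisy_triangles_def card_image inj_on_def split: prod.splits)
  also have "\<dots> = (\<Sum>e\<in>descending_pairs n. of_bool (i \<in> later_common_neighbors n A e \<and> R e))"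
    by (rule card_filter_eq_sum_of_bool) simp
  finally show ?thesis
    by (simp only: of_bool_conj)
qed

lemma card_later_common_neighbors:
  "card (later_common_neighbors n A e) = (\<Sum>i=1..n. of_bool (i \<in> later_common_neighbors n A e))"
proof -
  have "later_common_neighbors n A e \<subseteq> {1..n}"
    by (auto simp: later_common_neighbors_def split: prod.splits)
  then show ?thesis
    by (simp add: of_bool_def sum.If_cases Int_absorb1)
qed

text \<open>Exchanging the sums over users and pairs gathers all occurrences of one noisy bit. Users
  share these bits, so independence becomes available only in this form.\<close>

lemma sum_user_value_neighbors:
  "(\<Sum>i=1..n. user_value \<epsilon> (noisy_edges n R) (neighbors n A i) i) =
   (\<Sum>e\<in>descending_pairs n. real (card (later_common_neighbors n A e)) * (of_bool (R e) - flip_prob \<epsilon>))"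
proof -
  have "(\<Sum>i=1..n. user_value \<epsilon> (noisy_edges n R) (neighbors n A i) i) =
      (\<Sum>i=1..n. \<Sum>e\<in>descending_pairs n.
        of_bool (i \<in> later_common_neighbors n A e) * (of_bool (R e) - flip_prob \<epsilon>))"
  proof (rule sum.cong[OF refl])
    fix i assume i: "i \<in> {1..n}"
    show "user_value \<epsilon> (noisy_edges n R) (neighbors n A i) i =
        (\<Sum>e\<in>descending_pairs n.
          of_bool (i \<in> later_common_neighbors n A e) * (of_bool (R e) - flip_prob \<epsilon>))"
      unfolding user_value_def two_stars_neighbors[OF i] noisy_triangles_neighbors[OF i]
        of_nat_sum of_nat_mult of_nat_of_bool sum_distrib_left right_diff_distrib sum_subtractf
      by (simp only: mult.commute)
  qed
  also have "\<dots> = (\<Sum>e\<in>descending_pairs n. \<Sum>i=1..n.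
        of_bool (i \<in> later_common_neighbors n A e) * (of_bool (R e) - flip_prob \<epsilon>))"
    by (rule sum.swap)
  finally show ?thesis
    by (simp add: card_later_common_neighbors sum_distrib_right)
qed

text \<open>Sorting the nodes of a triangle as \<open>j < k < i\<close> identifies it with an edge
  \<open>(k, j)\<close> together with a later common neighbor \<open>i\<close> of its ends.\<close>

lemma triangle_count_eq_sum:
  assumes A: "adjacency_matrix n A"
  shows "triangle_count n A =
    (\<Sum>(k, j)\<in>descending_pairs n. card (later_common_neighbors n A (k, j)) * of_bool (A k j))"
proof -
  let ?D = "SIGMA e:{e \<in> descending_pairs n. A (fst e) (snd e)}. later_common_neighbors n A e"
  let ?T = "{T. T \<subseteq> {1..n} \<and> card T = 3 \<and> (\<forall>u\<in>T. \<forall>v\<in>T. u \<noteq> v \<longrightarrow> A u v)}"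
  let ?f = "\<lambda>((k, j), i). {i, k, j}"
  have sym: "A u v = A v u" if "u \<in> {1..n}" "v \<in> {1..n}" for u v
    using A that unfolding adjacency_matrix_def by blast
  have D: "((k, j), i) \<in> ?D \<longleftrightarrow> 1 \<le> j \<and> j < k \<and> k < i \<and> i \<le> n \<and> A k j \<and> A i k \<and> A i j" for i j k
    by (auto simp: descending_pairs_def later_common_neighbors_def)
  have "bij_betw ?f ?D ?T"
  proof (rule bij_betw_imageI)
    show "inj_on ?f ?D"
    proof (rule inj_onI)
      fix x y assume xy: "x \<in> ?D" "y \<in> ?D" "?f x = ?f y"
      obtain k j i k' j' i' where eqs: "x = ((k, j), i)" "y = ((k', j'), i')"
        by (metis surj_pair)
      have "j < k \<and> k < i" "j' < k' \<and> k' < i'"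
        using xy(1,2) unfolding eqs D by blast+
      moreover have "set [j, k, i] = set [j', k', i']"
        using xy(3) by (simp add: eqs insert_commute)
      \<comment> \<open>Strictly increasing lists with the same elements coincide.\<close>
      ultimately have "[j, k, i] = [j', k', i']"
        by (intro strict_sorted_equal) auto
      then show "x = y" by (simp add: eqs)
    qed
    show "?f ` ?D = ?T"
    proof (intro subset_antisym subsetI)
      fix T assume "T \<in> ?f ` ?D"
      then obtain k j i where "((k, j), i) \<in> ?D" and T: "T = {i, k, j}" by auto
      then have "1 \<le> j" "j < k" "k < i" "i \<le> n" "A k j" "A i k" "A i j" by (simp_all only: D)
      moreover from this have "A j k" "A k i" "A j i"
        using sym[of j k] sym[of k i] sym[of j i] by auto
      ultimately show "T \<in> ?T" by (auto simp: T)
    next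
      fix T assume T: "T \<in> ?T"
      \<comment> \<open>The preimage is read off from the sorted list of the three nodes.\<close>
      then have fin: "finite T" and "length (sorted_list_of_set T) = 3"
        by (auto simp: card_ge_0_finite)
      moreover have "\<exists>j k i. xs = [j, k, i]" if "length xs = 3" for xs :: "nat list"
        using that by (auto simp: numeral_3_eq_3 length_Suc_conv)
      ultimately obtain j k i where l: "sorted_list_of_set T = [j, k, i]"
        by blast
      have T_eq: "T = {i, k, j}"
        using set_sorted_list_of_set[OF fin] by (auto simp: l)
      have "j < k" "k < i"
        using strict_sorted_list_of_set[of T] by (auto simp: l)
      with T have "((k, j), i) \<in> ?D"
        unfolding D by (auto simp: T_eq)
      then show "T \<in> ?f ` ?D"
        by (rule rev_image_eqI) (simp add: T_eq)
    qed
  qed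
  then have "triangle_count n A = card ?D"
    by (simp add: triangle_count_def bij_betw_same_card)
  also have "\<dots> = (\<Sum>e\<in>{e \<in> descending_pairs n. A (fst e) (snd e)}. card (later_common_neighbors n A e))"
    by (rule card_SigmaI) auto
  also have "\<dots> = (\<Sum>e\<in>descending_pairs n. card (later_common_neighbors n A e) * of_bool (A (fst e) (snd e)))"
    by (rule sum.mono_neutral_cong_left) auto
  finally show ?thesis
    by (simp only: case_prod_unfold prod.collapse)
qed

section \<open>Degree bounds on the coefficients\<close>

lemma card_neighbors_le_max_degree:
  assumes "i \<in> {1..n}"
  shows "card (neighbors n A i) \<le> max_degree n A"
  using assms unfolding max_degree_def by (intro Max_ge) auto

lemma finite_neighbors [simp]: "finite (neighbors n A i)"
  by (simp add: neighbors_def)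

text \<open>By symmetry of the matrix, every later common neighbor is a neighbor of the larger node
  of the pair.\<close>

lemma card_later_common_neighbors_le:
  assumes A: "adjacency_matrix n A" and e: "e \<in> descending_pairs n"
  shows "card (later_common_neighbors n A e) \<le> max_degree n A"
proof -
  have "fst e \<in> {1..n}" using e by (auto simp: descending_pairs_def)
  moreover from this have "later_common_neighbors n A e \<subseteq> neighbors n A (fst e)"
    using A by (auto simp: later_common_neighbors_def neighbors_def adjacency_matrix_def)
  ultimately show ?thesis
    by (meson card_neighbors_le_max_degree card_mono finite_neighbors le_trans)
qed

text \<open>Double counting: a user \<open>i\<close> contributes to a pair only if both nodes are
  neighbors of \<open>i\<close>, hence to at most as many pairs as the square of its degree.\<close>

lemma sum_card_later_common_neighbors_le:
  "(\<Sum>e\<in>descending_pairs n. card (later_common_neighbors n A e)) \<le> n * (max_degree n A)\<^sup>2"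
proof -
  have "(\<Sum>e\<in>descending_pairs n. card (later_common_neighbors n A e)) =
      (\<Sum>i=1..n. card {e \<in> descending_pairs n. i \<in> later_common_neighbors n A e})"
    unfolding card_later_common_neighbors card_filter_eq_sum_of_bool[OF finite_descending_pairs]
    by (rule sum.swap)
  also have "\<dots> \<le> (\<Sum>i=1..n. (max_degree n A)\<^sup>2)"
  proof (rule sum_mono)
    fix i assume i: "i \<in> {1..n}"
    have "{e \<in> descending_pairs n. i \<in> later_common_neighbors n A e} \<subseteq>
        neighbors n A i \<times> neighbors n A i"
      by (auto simp: descending_pairs_def later_common_neighbors_def neighbors_def)
    then have "card {e \<in> descending_pairs n. i \<in> later_common_neighbors n A e} \<le>
        card (neighbors n A i) * card (neighbors n A i)"
      by (simp only: card_cartesian_product[symmetric]) (rule card_mono, simp_all)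
    also have "\<dots> \<le> (max_degree n A)\<^sup>2"
      unfolding power2_eq_square by (intro mult_mono card_neighbors_le_max_degree i) auto
    finally show "card {e \<in> descending_pairs n. i \<in> later_common_neighbors n A e} \<le>
        (max_degree n A)\<^sup>2" .
  qed
  finally show ?thesis by simp
qed

text \<open>One factor of each square is bounded uniformly by the maximum degree, the other is
  summed by double counting; this gives the exponent 3 = 1 + 2.\<close>

lemma sum_square_card_later_common_neighbors_le:
  assumes "adjacency_matrix n A"
  shows "(\<Sum>e\<in>descending_pairs n. (card (later_common_neighbors n A e))\<^sup>2) \<le> n * max_degree n A ^ 3"
proof -
  have "(\<Sum>e\<in>descending_pairs n. (card (later_common_neighbors n A e))\<^sup>2) \<le>
      (\<Sum>e\<in>descending_pairs n. max_degree n A * card (later_common_neighbors n A e))"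
    unfolding power2_eq_square
    by (intro sum_mono mult_right_mono card_later_common_neighbors_le assms) auto
  also have "\<dots> \<le> max_degree n A * (n * (max_degree n A)\<^sup>2)"
    unfolding sum_distrib_left[symmetric]
    by (intro mult_left_mono sum_card_later_common_neighbors_le) auto
  finally show ?thesis by (simp add: power2_eq_square power3_eq_cube mult_ac)
qed

section \<open>Variance of the randomized response\<close>

lemma flip_prob_bounds: "flip_prob \<epsilon> \<in> {0..1}"
  by (simp add: flip_prob_def field_simps add_pos_pos)

text \<open>Subtracting the mean \<open>p + (1 - 2p) a\<close> of a randomized response to the bit \<open>a\<close>.\<close>

definition centered_bit :: "real \<Rightarrow> bool \<Rightarrow> bool \<Rightarrow> real" where
  "centered_bit \<epsilon> a r = of_bool r - flip_prob \<epsilon> - (1 - 2 * flip_prob \<epsilon>) * of_bool a"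

text \<open>The released bit is Bernoulli with parameter \<open>p\<close> or \<open>1 - p\<close>,
  where \<open>p\<close> is \<open>flip_prob \<epsilon>\<close>. Both have the same variance, so the
  second moment does not depend on \<open>a\<close>.\<close>

lemma centered_bit_moments:
  shows "measure_pmf.expectation (randomized_response \<epsilon> a) (centered_bit \<epsilon> a) = 0"
    and "measure_pmf.expectation (randomized_response \<epsilon> a) (\<lambda>r. (centered_bit \<epsilon> a r)\<^sup>2) =
           flip_prob \<epsilon> * (1 - flip_prob \<epsilon>)"
  using flip_prob_bounds[of \<epsilon>]
  by (cases a; simp add: randomized_response_def centered_bit_def power2_eq_square algebra_simps)+

lemma first_round_error_square:
  fixes c :: "nat \<times> nat \<Rightarrow> real" and n :: nat and A :: "nat \<Rightarrow> nat \<Rightarrow> bool" and \<epsilon> :: real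
  defines "Z \<equiv> \<lambda>R. \<Sum>e\<in>descending_pairs n. c e * centered_bit \<epsilon> (A (fst e) (snd e)) (R e)"
  shows "integrable (first_round n A \<epsilon>) (\<lambda>R. (Z R)\<^sup>2)"
    and "measure_pmf.expectation (first_round n A \<epsilon>) (\<lambda>R. (Z R)\<^sup>2) =
      flip_prob \<epsilon> * (1 - flip_prob \<epsilon>) * (\<Sum>e\<in>descending_pairs n. (c e)\<^sup>2)"
proof -
  let ?F = "first_round n A \<epsilon>"
  let ?X = "\<lambda>e R. c e * centered_bit \<epsilon> (A (fst e) (snd e)) (R e)"
  have F: "?F = Pi_pmf (descending_pairs n) False (\<lambda>(i, j). randomized_response \<epsilon> (A i j))"
    by (simp add: first_round_def descending_pairs_def)
  have comp: "map_pmf (\<lambda>R. R e) ?F = randomized_response \<epsilon> (A (fst e) (snd e))"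
    if "e \<in> descending_pairs n" for e
    using that by (simp add: F Pi_pmf_component case_prod_unfold)
  have push: "measure_pmf.expectation ?F (\<lambda>R. h (R e)) =
      measure_pmf.expectation (randomized_response \<epsilon> (A (fst e) (snd e))) h"
    if "e \<in> descending_pairs n" for e and h :: "bool \<Rightarrow> real"
    unfolding comp[OF that, symmetric] by simp
  have int: "integrable ?F (\<lambda>R. (?X e R)\<^sup>2)" if "e \<in> descending_pairs n" for e
  proof -
    \<comment> \<open>A distribution on \<open>bool\<close> has finite support, so every real
      function of the bit is integrable.\<close>
    have "integrable (map_pmf (\<lambda>R. R e) ?F) (\<lambda>r. (c e * centered_bit \<epsilon> (A (fst e) (snd e)) r)\<^sup>2)"
      by (rule integrable_measure_pmf_finite) (rule finite_subset[OF subset_UNIV], simp)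
    then show ?thesis by (simp add: integrable_map_pmf_eq)
  qed
  have "prob_space.indep_vars ?F (\<lambda>_. count_space UNIV) (\<lambda>e R. R e) (descending_pairs n)"
    unfolding F by (rule indep_vars_Pi_pmf) simp
  then have indep: "prob_space.indep_vars ?F (\<lambda>_. borel) ?X (descending_pairs n)"
    by (rule prob_space.indep_vars_compose2[OF measure_pmf.prob_space_axioms]) simp
  have mean: "measure_pmf.expectation ?F (?X e) = 0" if "e \<in> descending_pairs n" for e
    using push[OF that, of "\<lambda>r. c e * centered_bit \<epsilon> (A (fst e) (snd e)) r"]
    by (simp add: centered_bit_moments)
  have var: "measure_pmf.expectation ?F (\<lambda>R. (?X e R)\<^sup>2) = flip_prob \<epsilon> * (1 - flip_prob \<epsilon>) * (c e)\<^sup>2"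
    if "e \<in> descending_pairs n" for e
    using push[OF that, of "\<lambda>r. (c e * centered_bit \<epsilon> (A (fst e) (snd e)) r)\<^sup>2"]
    by (simp add: centered_bit_moments power_mult_distrib mult.commute)
  note sq = prob_space.sum_indep_centered_square[OF measure_pmf.prob_space_axioms
      finite_descending_pairs indep int mean]
  show "integrable ?F (\<lambda>R. (Z R)\<^sup>2)"
    unfolding Z_def by (rule sq(1))
  show "measure_pmf.expectation ?F (\<lambda>R. (Z R)\<^sup>2) =
      flip_prob \<epsilon> * (1 - flip_prob \<epsilon>) * (\<Sum>e\<in>descending_pairs n. (c e)\<^sup>2)"
    unfolding Z_def sum_distrib_left
    by (rule trans[OF sq(2)]) (auto intro!: sum.cong var simp del: power_mult_distrib)
qed

section \<open>Projection, scaling factor and the combined error bound\<close>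

text \<open>No neighbor list exceeds the bound, so nothing is ever dropped. The value
  \<open>{}\<close> outside \<open>{1..n}\<close> is the default of \<open>Pi_pmf\<close>.\<close>

lemma projected_lists_eq_return:
  assumes "max_degree n A \<le> d"
  shows "projected_lists n A d = return_pmf (\<lambda>i. if i \<in> {1..n} then neighbors n A i else {})"
proof -
  have "projected_lists n A d = Pi_pmf {1..n} {} (\<lambda>i. return_pmf (neighbors n A i))"
    unfolding projected_lists_def
  proof (intro Pi_pmf_cong refl)
    fix i assume "i \<in> {1..n}"
    then have "card (neighbors n A i) \<le> d"
      using card_neighbors_le_max_degree assms le_trans by blast
    then show "graph_projection d (neighbors n A i) = return_pmf (neighbors n A i)"
      by (simp add: graph_projection_def)
  qed
  then show ?thesis by simp
qed

text \<open>With \<open>x = exp \<epsilon>\<close>, one has \<open>p = 1 / (x + 1)\<close>,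
  \<open>1 - p = x / (x + 1)\<close> and \<open>1 - 2 * p = (x - 1) / (x + 1)\<close>. The second
  claim is then an identity, and the factor 4 in the third comes from
  \<open>x + 1 \<le> 2 * x\<close>.\<close>

lemma flip_prob_scale:
  assumes "\<epsilon> > 0"
  shows "1 - 2 * flip_prob \<epsilon> > 0"
    and "flip_prob \<epsilon> * (1 - flip_prob \<epsilon>) / (1 - 2 * flip_prob \<epsilon>)\<^sup>2 = exp \<epsilon> / (1 - exp \<epsilon>)\<^sup>2"
    and "1 / (1 - 2 * flip_prob \<epsilon>)\<^sup>2 \<le> 4 * (exp \<epsilon> / (1 - exp \<epsilon>)\<^sup>2 * exp \<epsilon>)"
proof -
  define x where "x = exp \<epsilon>"
  have x: "x > 1" using assms by (simp add: x_def)
  have p: "flip_prob \<epsilon> = 1 / (x + 1)" by (simp add: flip_prob_def x_def)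
  have q: "1 - 2 * flip_prob \<epsilon> = (x - 1) / (x + 1)" using x by (simp add: p field_simps)
  have sq: "(1 - x)\<^sup>2 = (x - 1)\<^sup>2" by (rule power2_commute)
  show "1 - 2 * flip_prob \<epsilon> > 0" using x by (simp add: q)
  have "1 - flip_prob \<epsilon> = x / (x + 1)" using x by (simp add: p field_simps)
  then show "flip_prob \<epsilon> * (1 - flip_prob \<epsilon>) / (1 - 2 * flip_prob \<epsilon>)\<^sup>2 = exp \<epsilon> / (1 - exp \<epsilon>)\<^sup>2"
    using x unfolding q unfolding p x_def[symmetric] sq by (simp add: power_divide power2_eq_square)
  have "(x + 1)\<^sup>2 \<le> (2 * x)\<^sup>2" using x by (intro power_mono) auto
  then have "(x + 1)\<^sup>2 / (x - 1)\<^sup>2 \<le> (2 * x)\<^sup>2 / (x - 1)\<^sup>2"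
    by (rule divide_right_mono) simp
  then show "1 / (1 - 2 * flip_prob \<epsilon>)\<^sup>2 \<le> 4 * (exp \<epsilon> / (1 - exp \<epsilon>)\<^sup>2 * exp \<epsilon>)"
    unfolding q x_def[symmetric] sq by (simp add: power_divide power2_eq_square mult_ac)
qed

text \<open>A noisy bit minus \<open>p\<close> has mean \<open>1 - 2 * p\<close> times the true bit,
  so the noiseless estimate is unbiased; subtracting the triangle count replaces each term by its
  centered version.\<close>

lemma first_round_error_eq:
  assumes A: "adjacency_matrix n A" and "\<epsilon> > 0"
  shows "1 / (1 - 2 * flip_prob \<epsilon>) *
      (\<Sum>i=1..n. user_value \<epsilon> (noisy_edges n R) (neighbors n A i) i) - real (triangle_count n A) =
    1 / (1 - 2 * flip_prob \<epsilon>) *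
      (\<Sum>e\<in>descending_pairs n. real (card (later_common_neighbors n A e)) *
          centered_bit \<epsilon> (A (fst e) (snd e)) (R e))"
proof -
  let ?q = "1 - 2 * flip_prob \<epsilon>"
  let ?c = "\<lambda>e. real (card (later_common_neighbors n A e))"
  have q: "?q \<noteq> 0" using flip_prob_scale(1)[OF assms(2)] by simp
  \<comment> \<open>Multiplying and dividing by \<open>?q\<close> lets the count merge with the
    estimate under one factor.\<close>
  have "real (triangle_count n A) =
      1 / ?q * (\<Sum>e\<in>descending_pairs n. ?c e * (?q * of_bool (A (fst e) (snd e))))"
    using q by (simp add: triangle_count_eq_sum[OF A] case_prod_unfold sum_distrib_left)
  then show ?thesis
    unfolding sum_user_value_neighbors centered_bit_def
    by (simp only: right_diff_distrib[symmetric] sum_subtractf[symmetric])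
qed

theorem theorem6:
  "\<exists>C::real. C > 0 \<and>
     (\<forall>(\<epsilon>\<^sub>1::real) (\<epsilon>\<^sub>2::real) (d::nat) (n::nat) (A :: nat \<Rightarrow> nat \<Rightarrow> bool).
        \<epsilon>\<^sub>1 > 0 \<longrightarrow> \<epsilon>\<^sub>2 > 0 \<longrightarrow> adjacency_matrix n A \<longrightarrow> max_degree n A \<le> d \<longrightarrow>
        integrable (local_two_rounds_space n A \<epsilon>\<^sub>1 \<epsilon>\<^sub>2 d)
          (\<lambda>\<omega>. (local_two_rounds_output n \<epsilon>\<^sub>1 \<omega> - real (triangle_count n A))\<^sup>2) \<and>
        (LINT \<omega>|local_two_rounds_space n A \<epsilon>\<^sub>1 \<epsilon>\<^sub>2 d.
            (local_two_rounds_output n \<epsilon>\<^sub>1 \<omega> - real (triangle_count n A))\<^sup>2)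
          \<le> C * (exp \<epsilon>\<^sub>1 / (1 - exp \<epsilon>\<^sub>1)\<^sup>2 *
                 (real d ^ 3 * real n + exp \<epsilon>\<^sub>1 / \<epsilon>\<^sub>2\<^sup>2 * real d ^ 2 * real n)))"
proof (intro exI[of _ 16] conjI allI impI)
  \<comment> \<open>The constant is dictated by the Laplace part: 2 from splitting the square, 2
    from the Laplace variance and 4 from \<open>flip_prob_scale\<close>. The randomized response
    part has constant 2.\<close>
  show "(16::real) > 0" by simp
next
  fix \<epsilon>\<^sub>1 \<epsilon>\<^sub>2 :: real and d n :: nat and A :: "nat \<Rightarrow> nat \<Rightarrow> bool"
  assume \<epsilon>\<^sub>1: "\<epsilon>\<^sub>1 > 0" and \<epsilon>\<^sub>2: "\<epsilon>\<^sub>2 > 0" and A: "adjacency_matrix n A" and d: "max_degree n A \<le> d"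
  let ?space = "local_two_rounds_space n A \<epsilon>\<^sub>1 \<epsilon>\<^sub>2 d"
  let ?err = "\<lambda>\<omega>. (local_two_rounds_output n \<epsilon>\<^sub>1 \<omega> - real (triangle_count n A))\<^sup>2"
  define p where "p = flip_prob \<epsilon>\<^sub>1"
  define q where "q = 1 - 2 * p"
  define b where "b = real d / \<epsilon>\<^sub>2"
  define c where "c e = real (card (later_common_neighbors n A e))" for e
  define Z where "Z R = (\<Sum>e\<in>descending_pairs n. c e * centered_bit \<epsilon>\<^sub>1 (A (fst e) (snd e)) (R e))"
    for R
  define F where "F = first_round n A \<epsilon>\<^sub>1"
  define N where "N i = (if i \<in> {1..n} then neighbors n A i else {})" for i
  let ?Lap = "\<Pi>\<^sub>M i\<in>{1..n}. laplace b"
  let ?M = "map_pmf (\<lambda>R. (R, N)) F"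
  have b: "b \<ge> 0" using \<epsilon>\<^sub>2 by (simp add: b_def)
  \<comment> \<open>The projected lists are deterministic, so the discrete factor reduces to the
    first round paired with the fixed \<open>N\<close>.\<close>
  have space: "?space = measure_pmf ?M \<Otimes>\<^sub>M ?Lap"
    by (simp add: local_two_rounds_space_def projected_lists_eq_return[OF d] pair_return_pmf2
        F_def b_def N_def[abs_def])
  let ?f = "\<lambda>(R, N). 1 / q * (\<Sum>i=1..n. user_value \<epsilon>\<^sub>1 (noisy_edges n R) (N i) i) -
    real (triangle_count n A)"
  let ?g = "\<lambda>L. (\<Sum>i=1..n. L i) / q"
  \<comment> \<open>The error splits into a part depending on the discrete choices and a part
    depending on the Laplace noise, matching the two factors of the space.\<close>
  have err: "?err = (\<lambda>z. (?f (fst z) + ?g (snd z))\<^sup>2)"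
    by (auto simp: fun_eq_iff local_two_rounds_output_def q_def p_def sum.distrib add_divide_distrib
        algebra_simps)
  have f_eq: "?f (R, N) = Z R / q" for R
    using first_round_error_eq[OF A \<epsilon>\<^sub>1, of R] by (simp add: N_def Z_def c_def q_def p_def)
  have f: "integrable ?M (\<lambda>x. (?f x)\<^sup>2)"
      "(LINT x|?M. (?f x)\<^sup>2) = p * (1 - p) / q\<^sup>2 * (\<Sum>e\<in>descending_pairs n. (c e)\<^sup>2)"
    using first_round_error_square[where n = n and A = A and \<epsilon> = \<epsilon>\<^sub>1 and c = c]
    unfolding integrable_map_pmf_eq integral_map_pmf f_eq
    by (simp_all add: power_divide F_def Z_def p_def)
  have g: "integrable ?Lap (\<lambda>L. (?g L)\<^sup>2)" "(LINT L|?Lap. (?g L)\<^sup>2) = 2 * b\<^sup>2 * real n / q\<^sup>2"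
    using laplace_noise_sum_square[OF b, of "{1..n}"] by (simp_all add: power_divide)
  have prob: "prob_space (measure_pmf ?M)" "prob_space ?Lap"
    by (auto intro!: prob_space_PiM laplace_moments b measure_pmf.prob_space_axioms)
  have f_meas: "?f \<in> borel_measurable (measure_pmf ?M)" by simp
  have g_meas: "?g \<in> borel_measurable ?Lap" by measurable
  note total = pair_measure_integral_square_add_le[OF prob f_meas g_meas f(1) g(1)]
  show "integrable ?space ?err"
    unfolding space err by (rule total)
  let ?K = "exp \<epsilon>\<^sub>1 / (1 - exp \<epsilon>\<^sub>1)\<^sup>2"
  have "(\<Sum>e\<in>descending_pairs n. (c e)\<^sup>2) \<le> real (n * max_degree n A ^ 3)"
    using of_nat_mono[OF sum_square_card_later_common_neighbors_le[OF A], where ?'a = real]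
    by (simp add: c_def)
  also have "\<dots> \<le> real (n * d ^ 3)"
    using d by (intro of_nat_mono mult_left_mono power_mono) auto
  finally have sum_c: "(\<Sum>e\<in>descending_pairs n. (c e)\<^sup>2) \<le> real d ^ 3 * real n"
    by (simp add: mult.commute)
  have "(LINT \<omega>|?space. ?err \<omega>) \<le> 2 * (LINT x|?M. (?f x)\<^sup>2) + 2 * (LINT L|?Lap. (?g L)\<^sup>2)"
    unfolding space err by (rule total)
  also have "\<dots> = 2 * (?K * (\<Sum>e\<in>descending_pairs n. (c e)\<^sup>2)) + 4 * (1 / q\<^sup>2 * (b\<^sup>2 * real n))"
    unfolding f g using flip_prob_scale(2)[OF \<epsilon>\<^sub>1] by (simp add: p_def q_def)
  also have "\<dots> \<le> 2 * (?K * (real d ^ 3 * real n)) + 4 * (4 * (?K * exp \<epsilon>\<^sub>1) * (b\<^sup>2 * real n))"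
    using flip_prob_scale(3)[OF \<epsilon>\<^sub>1] sum_c
    by (intro add_mono mult_left_mono mult_right_mono) (auto simp: p_def q_def)
  \<comment> \<open>The first constant is raised from 2 to 16 to share a common factor with the
    second term.\<close>
  also have "\<dots> \<le> 16 * (?K * (real d ^ 3 * real n)) + 4 * (4 * (?K * exp \<epsilon>\<^sub>1) * (b\<^sup>2 * real n))"
    by (intro add_mono mult_right_mono order_refl) auto
  also have "\<dots> = 16 * (?K * (real d ^ 3 * real n + exp \<epsilon>\<^sub>1 / \<epsilon>\<^sub>2\<^sup>2 * real d ^ 2 * real n))"
    by (simp add: b_def power_divide distrib_left)
  finally show "(LINT \<omega>|?space. ?err \<omega>) \<le> 16 * (?K *
      (real d ^ 3 * real n + exp \<epsilon>\<^sub>1 / \<epsilon>\<^sub>2\<^sup>2 * real d ^ 2 * real n))" .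
qed

end
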